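(* Let $G$ be a finite simple graph that does not contain a 4-vertex cycle $C_4$ as an induced subgraph. Then $G$ is strongly reconstructible from the set $\mathrm{supp}(\mathcal{N}[G]) = \{N_G[v] : v \in V(G)\}$ of its closed neighborhoods; that is, for every graph $H$ on the same vertex set as $G$, the equality $\mathrm{supp}(\mathcal{N}[G]) = \mathrm{supp}(\mathcal{N}[H])$ implies $G = H$.
   Context: All graphs are simple and finite. For a vertex $v$ of a graph $G$, the closed neighborhood is $N_G[v] = \{v\} \cup N_G(v)$, where $N_G(v)$ is the set of vertices adjacent to $v$. $\mathcal{N}[G]$ denotes the multiset $\{N_G[v] : v \in V(G)\}$, and $\mathrm{supp}(M)$ denotes the set of elements of a multiset $M$ having positive multiplicity. Thus $\mathrm{supp}(\mathcal{N}[G])$ is the set (without multiplicities) of all closed neighborhoods of vertices of $G$. A (labeled) graph $G$ is strongly reconstructible from a parameter $p(G)$ if, for every (labeled) graph $H$ on the same vertex set as $G$, $p(G) = p(H)$ implies $G = H$ (equality of labeled graphs, i.e. the same edge set). *)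

theory Defs
  imports "Graph_Theory.Graph_Theory" "HOL-Library.Multiset"
begin

text \<open>
  Finite simple labeled graphs are values of type \<^typ>\<open>'a pair_pre_digraph\<close> satisfying
  \<^const>\<open>pair_graph\<close>: finite, loop-free, and with a symmetric arc set, an undirected edge \<open>uv\<close>
  being the two arcs \<open>(u, v)\<close> and \<open>(v, u)\<close>. There are no further record fields, so HOL equality
  of such values is equality of labeled graphs.
\<close>

definition neighborhood :: "'a pair_pre_digraph \<Rightarrow> 'a \<Rightarrow> 'a set" where
  "neighborhood G v = {u \<in> pverts G. v \<rightarrow>\<^bsub>G\<^esub> u}"

definition closed_neighborhood :: "'a pair_pre_digraph \<Rightarrow> 'a \<Rightarrow> 'a set" where
  "closed_neighborhood G v = {v} \<union> neighborhood G v"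

text \<open>
  The multiset \<open>{N[v] : v \<in> V}\<close>; its support is obtained with \<^const>\<open>set_mset\<close>. It is only
  meaningful for finite graphs, as \<^const>\<open>mset_set\<close> of an infinite set is empty.
\<close>
definition closed_neighborhoods :: "'a pair_pre_digraph \<Rightarrow> 'a set multiset" where
  "closed_neighborhoods G = image_mset (closed_neighborhood G) (mset_set (pverts G))"

text \<open>
  The cycle on \<open>0, \<dots>, n - 1\<close>, meant for \<open>n \<ge> 3\<close> (for \<open>n = 1\<close> it is a loop, for \<open>n = 2\<close>
  a single edge).
\<close>
definition cycle_graph :: "nat \<Rightarrow> nat pair_pre_digraph" where
  "cycle_graph n =
    \<lparr>pverts = {..<n},
     parcs = {(i, j). i < n \<and> j < n \<and> (j = Suc i mod n \<or> i = Suc j mod n)}\<rparr>"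

definition contains_induced :: "'a pair_pre_digraph \<Rightarrow> 'b pair_pre_digraph \<Rightarrow> bool" where
  "contains_induced G F \<longleftrightarrow>
    (\<exists>K. induced_subgraph K (with_proj G) \<and> digraph_iso (with_proj F) K)"

definition strongly_reconstructible ::
    "('a pair_pre_digraph \<Rightarrow> 'p) \<Rightarrow> 'a pair_pre_digraph \<Rightarrow> bool" where
  "strongly_reconstructible p G \<longleftrightarrow>
    (\<forall>H. pair_graph H \<and> pverts H = pverts G \<and> p G = p H \<longrightarrow> G = H)"

end

theory Submission
  imports Defs
begin

text \<open>
  Suppose that \<open>G\<close> and \<open>H\<close> have the same set of closed neighborhoods, and choose for every vertex
  \<open>v\<close> a vertex \<open>f v\<close> with \<open>N\<^sub>G[v] = N\<^sub>H[f v]\<close>. Everything rests on the fact that \<open>f\<close> is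
  self-adjoint for the reflexive adjacency of \<open>G\<close>:
  \<open>f a \<in> N\<^sub>G[b] = N\<^sub>H[f b]\<close> iff \<open>f b \<in> N\<^sub>H[f a] = N\<^sub>G[a]\<close>. Consequently \<open>f\<^sup>i a\<close> and \<open>f\<^sup>j b\<close>
  are adjacent or equal in \<open>G\<close> iff \<open>i + j\<close> lies in a set \<open>T\<close> of exponents that depends only on
  \<open>a\<close> and \<open>b\<close>. As \<open>f a \<in> N\<^sub>H[f a] = N\<^sub>G[a]\<close>, for \<open>a = b\<close> this set is everything, that is, every
  orbit of \<open>f\<close> is a clique of \<open>G\<close>.

  Two vertices are twins (have the same closed neighborhood) iff every closed neighborhood
  contains both or neither of them. Hence \<open>G\<close> and \<open>H\<close> have the same twins, \<open>f\<close> is injective up to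
  twins, and by finiteness \<open>T\<close> is purely periodic. If \<open>T\<close> is neither empty nor everything, it
  therefore has both an exit \<open>n \<in> T\<close>, \<open>n + 1 \<notin> T\<close> and an entry \<open>m \<notin> T\<close>, \<open>m + 1 \<in> T\<close>, and
  \<open>f\<^sup>n a\<close>, \<open>b\<close>, \<open>f b\<close>, \<open>f\<^sup>m a\<close> is an induced 4-cycle: two of its edges lie inside orbits, and exit
  and entry give the other two edges and both missing diagonals.

  So without an induced 4-cycle \<open>a\<close> and \<open>f a\<close> are twins in \<open>G\<close>. Undoing the choice of \<open>f\<close>,
  again up to twins, yields \<open>N\<^sub>G[a] = N\<^sub>H[a]\<close> for every vertex \<open>a\<close>, which is the claim.
\<close>

section \<open>Self-adjoint maps of a reflexive graph\<close>

text \<open>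
  The closed neighborhoods of a finite graph, encoded as a reflexive symmetric family \<open>N\<close>, with
  the properties of the map \<open>f\<close> above. Injectivity can only be asked for up to twins: if \<open>G\<close> has
  twins, \<open>f\<close> may well send all vertices of a twin class to one vertex.
\<close>
locale self_adjoint_map =
  fixes V :: "'a set" and N :: "'a \<Rightarrow> 'a set" and f :: "'a \<Rightarrow> 'a"
  assumes finite_V: "finite V"
    and N_refl: "a \<in> V \<Longrightarrow> a \<in> N a"
    and N_sym: "\<lbrakk>a \<in> V; b \<in> V\<rbrakk> \<Longrightarrow> a \<in> N b \<longleftrightarrow> b \<in> N a"
    and f_closed: "a \<in> V \<Longrightarrow> f a \<in> V"
    and f_adjoint: "\<lbrakk>a \<in> V; b \<in> V\<rbrakk> \<Longrightarrow> f a \<in> N b \<longleftrightarrow> a \<in> N (f b)"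
    and f_near: "a \<in> V \<Longrightarrow> f a \<in> N a"
    and f_inj_twins: "\<lbrakk>a \<in> V; b \<in> V; N (f a) = N (f b)\<rbrakk> \<Longrightarrow> N a = N b"
begin

lemma funpow_closed: "a \<in> V \<Longrightarrow> (f ^^ n) a \<in> V"
  by (induction n) (auto intro: f_closed)

lemma funpow_adjoint:
  assumes "a \<in> V" "b \<in> V"
  shows "(f ^^ n) a \<in> N b \<longleftrightarrow> a \<in> N ((f ^^ n) b)"
  using assms(2)
proof (induction n arbitrary: b)
  case (Suc n)
  have "(f ^^ Suc n) a \<in> N b \<longleftrightarrow> (f ^^ n) a \<in> N (f b)"
    using f_adjoint funpow_closed assms(1) Suc.prems by simp
  also have "\<dots> \<longleftrightarrow> a \<in> N ((f ^^ n) (f b))"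
    using Suc f_closed by blast
  finally show ?case
    by (simp add: funpow_swap1)
qed simp

lemma funpow_inj_twins:
  assumes "a \<in> V" "b \<in> V" "N ((f ^^ n) a) = N ((f ^^ n) b)"
  shows "N a = N b"
  using assms(3)
proof (induction n)
  case (Suc n)
  then show ?case
    using f_inj_twins[OF funpow_closed[OF assms(1)] funpow_closed[OF assms(2)], of n n] by simp
qed simp

text \<open>
  By self-adjointness \<open>f\<^sup>n a\<close> is joined to \<open>a\<close> iff \<open>f\<^bsup>n-i\<^esup> a\<close> is joined to \<open>f\<^sup>i a\<close>; balancing
  the two exponents reduces to \<open>N_refl\<close> for even \<open>n\<close> and to \<open>f_near\<close> for odd \<open>n\<close>.
\<close>
lemma funpow_near:
  assumes "a \<in> V"
  shows "(f ^^ n) a \<in> N a"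
proof -
  define k where "k = n div 2"
  have closed: "(f ^^ k) a \<in> V"
    using assms by (rule funpow_closed)
  consider "n = k + k" | "n = k + Suc k"
    unfolding k_def by linarith
  then show ?thesis
  proof cases
    case 1
    then have "(f ^^ n) a = (f ^^ k) ((f ^^ k) a)"
      by (simp add: funpow_add)
    then show ?thesis
      using funpow_adjoint[OF closed assms] N_refl[OF closed] by simp
  next
    case 2
    then have "(f ^^ n) a = (f ^^ k) (f ((f ^^ k) a))"
      by (simp add: funpow_add funpow_swap1)
    then show ?thesis
      using funpow_adjoint[OF f_closed[OF closed] assms] f_near[OF closed] by simp
  qed
qed

lemma orbit_is_clique:
  assumes "a \<in> V"
  shows "(f ^^ i) a \<in> N ((f ^^ j) a)"
proof -
  have "(f ^^ (j + i)) a \<in> N a"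
    using assms by (rule funpow_near)
  then show ?thesis
    using funpow_adjoint[OF funpow_closed assms] assms by (simp add: funpow_add)
qed

text \<open>
  The orbit revisits a vertex because \<open>V\<close> is finite, and injectivity up to twins cancels the
  iterations before the first visit.
\<close>
lemma orbit_periodic_up_to_twins:
  assumes "a \<in> V"
  obtains p where "p > 0" "N ((f ^^ p) a) = N a"
proof -
  have "\<not> inj (\<lambda>n. (f ^^ n) a)"
    using finite_V assms funpow_closed
    by (metis (no_types, lifting) finite_subset image_subsetI infinite_UNIV_nat finite_imageD)
  then obtain i j where ij: "i < j" "(f ^^ i) a = (f ^^ j) a"
    unfolding inj_def by (metis nat_neq_iff)
  then have "(f ^^ i) ((f ^^ (j - i)) a) = (f ^^ i) a"
    using funpow_add[of i "j - i" f] by simp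
  then have "N ((f ^^ (j - i)) a) = N a"
    using funpow_inj_twins funpow_closed assms by metis
  with ij(1) show ?thesis
    by (intro that[of "j - i"]) auto
qed

end

text \<open>
  Between an exit at \<open>n\<close> and the next recurrence of \<open>P\<close> there is an entry, and conversely.
\<close>
lemma periodic_change_both_ways:
  fixes P :: "nat \<Rightarrow> bool"
  assumes "p > 0" "\<And>n. P (n + p) = P n" "P 0 \<noteq> P 1"
  obtains n m where "P n" "\<not> P (Suc n)" "\<not> P m" "P (Suc m)"
proof -
  have rises: "\<exists>m. \<not> Q m \<and> Q (Suc m)" if "\<not> Q i" "Q j" "i \<le> j" for Q :: "nat \<Rightarrow> bool" and i j
    using that(3,2,1) by (induction rule: dec_induct) auto
  have "P p = P 0" "P (Suc p) = P 1"
    using assms(2)[of 0] assms(2)[of 1] by simp_all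
  with assms(1,3) have "\<exists>m. \<not> P m \<and> P (Suc m)" "\<exists>n. P n \<and> \<not> P (Suc n)"
    using rises[of P 0 1] rises[of P 1 p] rises[of "\<lambda>n. \<not> P n" 0 1] rises[of "\<lambda>n. \<not> P n" 1 p]
    by auto
  then show ?thesis
    using that by blast
qed

text \<open>
  The four conditions on closed neighborhoods that describe the induced 4-cycle \<open>x, c, d, y\<close>
  already force its vertices to be distinct, which is why distinctness is not mentioned.
\<close>
lemma (in self_adjoint_map) induced_four_cycle:
  assumes a: "a \<in> V" and b: "b \<in> V" and change: "f a \<in> N b \<longleftrightarrow> a \<notin> N b"
  obtains x c d y where "{x, c, d, y} \<subseteq> V"
    "x \<in> N c" "c \<in> N d" "d \<in> N y" "y \<in> N x" "x \<notin> N d" "y \<notin> N c"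
proof -
  obtain p where p: "p > 0" "N ((f ^^ p) a) = N a"
    using orbit_periodic_up_to_twins[OF a] .
  define P where "P n \<longleftrightarrow> (f ^^ n) a \<in> N b" for n
  have "P (n + p) = P n" for n
  proof -
    have "P (n + p) \<longleftrightarrow> (f ^^ p) a \<in> N ((f ^^ n) b)"
      unfolding P_def using funpow_adjoint[OF funpow_closed[OF a] b] by (simp add: funpow_add)
    also have "\<dots> \<longleftrightarrow> a \<in> N ((f ^^ n) b)"
      using N_sym[OF funpow_closed[OF b] funpow_closed[OF a], of n p]
        N_sym[OF funpow_closed[OF b] a, of n] p(2) by blast
    also have "\<dots> \<longleftrightarrow> P n"
      unfolding P_def using funpow_adjoint[OF a b] by simp
    finally show ?thesis .
  qed
  moreover have "P 0 \<noteq> P 1"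
    unfolding P_def using change by simp
  ultimately obtain n m where nm: "P n" "\<not> P (Suc n)" "\<not> P m" "P (Suc m)"
    using periodic_change_both_ways[of p P] p(1) by blast
  have Suc_iff: "P (Suc k) \<longleftrightarrow> (f ^^ k) a \<in> N (f b)" for k
    unfolding P_def using f_adjoint[OF funpow_closed[OF a] b] by simp
  have "{(f ^^ n) a, b, f b, (f ^^ m) a} \<subseteq> V"
    using a b f_closed funpow_closed by simp
  moreover have "f b \<in> N ((f ^^ m) a)" "b \<in> N (f b)"
    using nm(4) Suc_iff N_sym[OF f_closed[OF b] funpow_closed[OF a]] f_near[OF b]
      N_sym[OF b f_closed[OF b]] by blast+
  ultimately show ?thesis
    using nm that[of "(f ^^ n) a" b "f b" "(f ^^ m) a"] orbit_is_clique[OF a] Suc_iff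
    unfolding P_def by blast
qed

section \<open>Closed neighborhoods in simple graphs\<close>

lemma mem_closed_neighborhood:
  assumes "pair_graph G"
  shows "u \<in> closed_neighborhood G v \<longleftrightarrow> u = v \<or> (v, u) \<in> parcs G"
proof -
  interpret pair_graph G by fact
  show ?thesis
    unfolding closed_neighborhood_def neighborhood_def by (auto dest: in_arcsD2)
qed

lemma closed_neighborhood_sym:
  assumes "pair_graph G"
  shows "u \<in> closed_neighborhood G v \<longleftrightarrow> v \<in> closed_neighborhood G u"
proof -
  interpret pair_graph G by fact
  have "(u, v) \<in> parcs G \<longleftrightarrow> (v, u) \<in> parcs G"
    using arcs_ends_symmetric[OF sym_arcs] by auto
  then show ?thesis
    unfolding mem_closed_neighborhood[OF assms] by auto
qed

lemma set_mset_closed_neighborhoods: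
  assumes "pair_graph G"
  shows "set_mset (closed_neighborhoods G) = closed_neighborhood G ` pverts G"
proof -
  interpret pair_graph G by fact
  show ?thesis
    unfolding closed_neighborhoods_def by simp
qed

lemma closed_neighborhood_subset:
  assumes "v \<in> pverts G"
  shows "closed_neighborhood G v \<subseteq> pverts G"
  using assms unfolding closed_neighborhood_def neighborhood_def by auto

text \<open>
  By symmetry, \<open>u \<in> N[w]\<close> may be read as \<open>w \<in> N[u]\<close>; so the family of all closed neighborhoods
  knows which vertices are twins.
\<close>
lemma twins_iff_not_separated:
  assumes "pair_graph G" "u \<in> pverts G" "v \<in> pverts G"
  shows "closed_neighborhood G u = closed_neighborhood G v \<longleftrightarrow>
    (\<forall>S \<in> closed_neighborhood G ` pverts G. u \<in> S \<longleftrightarrow> v \<in> S)"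
proof -
  have "closed_neighborhood G u = closed_neighborhood G v \<longleftrightarrow>
      (\<forall>w \<in> pverts G. w \<in> closed_neighborhood G u \<longleftrightarrow> w \<in> closed_neighborhood G v)"
    using closed_neighborhood_subset[OF assms(2)] closed_neighborhood_subset[OF assms(3)]
    by blast
  then show ?thesis
    by (simp add: closed_neighborhood_sym[OF assms(1), of _ u]
        closed_neighborhood_sym[OF assms(1), of _ v])
qed

lemma pair_graph_eqI:
  assumes "pair_graph G" "pair_graph H" "pverts H = pverts G"
    and "\<And>v. v \<in> pverts G \<Longrightarrow> closed_neighborhood G v = closed_neighborhood H v"
  shows "G = H"
proof -
  interpret G: pair_graph G by fact
  interpret H: pair_graph H by fact
  have "(v, u) \<in> parcs G \<longleftrightarrow> (v, u) \<in> parcs H" for u v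
  proof (cases "v \<in> pverts G \<and> u \<noteq> v")
    case True
    then show ?thesis
      using assms(4)[of v] mem_closed_neighborhood[OF assms(1), of u v]
        mem_closed_neighborhood[OF assms(2), of u v] by blast
  next
    case False
    then show ?thesis
      using G.pair_no_loops H.pair_no_loops G.in_arcsD1 H.in_arcsD1 assms(3) by fastforce
  qed
  then have "parcs G = parcs H"
    by auto
  with assms(3) show ?thesis
    by simp
qed

text \<open>
  Translates an induced 4-cycle \<open>x, c, d, y\<close>, given by the pattern of \<open>induced_four_cycle\<close>, into
  an isomorphic copy of \<open>cycle_graph 4\<close> that maps \<open>0, 1, 2, 3\<close> to \<open>x, c, d, y\<close>.
\<close>
lemma contains_induced_cycle_graph_4:
  assumes G: "pair_graph G" and V: "{x, c, d, y} \<subseteq> pverts G"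
    and edges: "x \<in> closed_neighborhood G c" "c \<in> closed_neighborhood G d"
      "d \<in> closed_neighborhood G y" "y \<in> closed_neighborhood G x"
    and diagonals: "x \<notin> closed_neighborhood G d" "y \<notin> closed_neighborhood G c"
  shows "contains_induced G (cycle_graph 4)"
proof -
  interpret pair_graph G by fact
  note mem = mem_closed_neighborhood[OF G]
  have sym: "(u, v) \<in> parcs G \<longleftrightarrow> (v, u) \<in> parcs G" for u v
    using arcs_ends_symmetric[OF sym_arcs] by auto
  have loopfree: "(u, u) \<notin> parcs G" for u
    using pair_no_loops by fastforce
  have neq: "x \<noteq> c" "x \<noteq> d" "x \<noteq> y" "c \<noteq> d" "c \<noteq> y" "d \<noteq> y"
    using edges diagonals closed_neighborhood_sym[OF G] mem by blast+
  have arcs: "(x, c) \<in> parcs G" "(c, d) \<in> parcs G" "(d, y) \<in> parcs G" "(y, x) \<in> parcs G"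
    "(c, x) \<in> parcs G" "(d, c) \<in> parcs G" "(y, d) \<in> parcs G" "(x, y) \<in> parcs G"
    "(x, d) \<notin> parcs G" "(d, x) \<notin> parcs G" "(y, c) \<notin> parcs G" "(c, y) \<notin> parcs G"
    using edges[unfolded mem] diagonals[unfolded mem] neq sym by metis+
  define h :: "nat \<Rightarrow> 'a" where "h i = [x, c, d, y] ! i" for i
  have h: "h 0 = x" "h 1 = c" "h 2 = d" "h 3 = y" "h (Suc 0) = c"
    unfolding h_def by (simp_all add: numeral_eq_Suc)
  have four: "{..<4} = {0, 1, 2, 3 :: nat}"
    by auto
  have C_verts: "pverts (cycle_graph 4) = {0, 1, 2, 3}"
    unfolding cycle_graph_def using four by simp
  have C_arcs: "parcs (cycle_graph 4) =
      {(0, 1), (1, 0), (1, 2), (2, 1), (2, 3), (3, 2), (3, 0), (0, 3)}" (is "_ = ?C")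
  proof -
    have "parcs (cycle_graph 4) =
        Set.filter (\<lambda>(i, j). j = Suc i mod 4 \<or> i = Suc j mod 4) ({..<4} \<times> {..<4})"
      unfolding cycle_graph_def by auto
    also have "\<dots> = ?C"
      unfolding four by (rule set_eqI) (auto simp del: mod_Suc)
    finally show ?thesis .
  qed
  define K where "K = \<lparr>verts = {x, c, d, y},
    arcs = {e \<in> parcs G. fst e \<in> {x, c, d, y} \<and> snd e \<in> {x, c, d, y}}, tail = fst, head = snd\<rparr>"
  have "wf_digraph K"
    unfolding K_def wf_digraph_def by auto
  then have "induced_subgraph K (with_proj G)"
    using V wf_digraph_axioms
    unfolding induced_subgraph_def subgraph_def compatible_def K_def by auto
  moreover have "digraph_iso (with_proj (cycle_graph 4)) K"
  proof -
    define hom where "hom = \<lparr>iso_verts = h, iso_arcs = map_prod h h, iso_head = snd,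
      iso_tail = fst\<rparr>"
    have inj: "inj_on h {0, 1, 2, 3}"
      using neq unfolding inj_on_def by (auto simp: h)
    have "?C \<subseteq> {0, 1, 2, 3} \<times> {0, 1, 2, 3}"
      by auto
    then have "inj_on (map_prod h h) ?C"
      by (rule inj_on_subset[OF map_prod_inj_on[OF inj inj]])
    with inj have "pre_digraph.digraph_isomorphism (with_proj (cycle_graph 4)) hom"
      unfolding pre_digraph.digraph_isomorphism_def wf_digraph_def hom_def
      by (auto simp: C_verts C_arcs)
    moreover have "K = app_iso hom (with_proj (cycle_graph 4))"
    proof -
      have "arcs K = map_prod h h ` ?C"
      proof -
        have image: "map_prod h h ` ?C =
            {(x, c), (c, x), (c, d), (d, c), (d, y), (y, d), (y, x), (x, y)}"
          by (simp add: h)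
        have "(u, v) \<in> map_prod h h ` ?C"
          if "u \<in> {x, c, d, y}" "v \<in> {x, c, d, y}" "(u, v) \<in> parcs G" for u v
          using that unfolding image by (elim insertE emptyE; simp add: arcs loopfree)
        then have "arcs K \<subseteq> map_prod h h ` ?C"
          unfolding K_def by (simp add: subset_iff del: image_insert insert_iff)
        moreover have "map_prod h h ` ?C \<subseteq> arcs K"
          unfolding image K_def by (simp add: arcs)
        ultimately show ?thesis
          by (rule antisym)
      qed
      then show ?thesis
        unfolding K_def app_iso_def hom_def by (auto simp: C_verts C_arcs h)
    qed
    ultimately show ?thesis
      unfolding digraph_iso_def by blast
  qed
  ultimately show ?thesis
    unfolding contains_induced_def by blast
qed

section \<open>Reconstruction from the set of closed neighborhoods\<close>

theorem theorem1p2: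
  fixes G :: "'a pair_pre_digraph"
  assumes "pair_graph G"
    and "\<not> contains_induced G (cycle_graph 4)"
  shows "strongly_reconstructible (\<lambda>K. set_mset (closed_neighborhoods K)) G"
  unfolding strongly_reconstructible_def
proof (intro allI impI, elim conjE)
  fix H :: "'a pair_pre_digraph"
  assume H: "pair_graph H" and V: "pverts H = pverts G"
    and "set_mset (closed_neighborhoods G) = set_mset (closed_neighborhoods H)"
  let ?NG = "closed_neighborhood G" and ?NH = "closed_neighborhood H" and ?V = "pverts G"
  have supp: "?NG ` ?V = ?NH ` ?V"
    using \<open>set_mset _ = _\<close> set_mset_closed_neighborhoods[OF assms(1)]
      set_mset_closed_neighborhoods[OF H] V by simp
  have twins: "?NG u = ?NG v \<longleftrightarrow> ?NH u = ?NH v" if "u \<in> ?V" "v \<in> ?V" for u v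
    using twins_iff_not_separated[OF assms(1), of u v] twins_iff_not_separated[OF H, of u v]
      that V supp by simp
  have refl: "v \<in> ?NG v" "v \<in> ?NH v" for v
    unfolding closed_neighborhood_def by simp_all
  note symG = closed_neighborhood_sym[OF assms(1)] and symH = closed_neighborhood_sym[OF H]
  have "\<forall>v\<in>?V. \<exists>w\<in>?V. ?NG v = ?NH w"
    using supp by blast
  then obtain f where f: "\<And>v. v \<in> ?V \<Longrightarrow> f v \<in> ?V" "\<And>v. v \<in> ?V \<Longrightarrow> ?NG v = ?NH (f v)"
    by metis
  interpret self_adjoint_map ?V ?NG f
  proof
    interpret pair_graph G by fact
    show "finite ?V"
      by (rule pair_finite_verts)
    show "a \<in> ?NG a" for a
      by (rule refl)
    show "a \<in> ?NG b \<longleftrightarrow> b \<in> ?NG a" for a b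
      by (rule symG)
    show "f a \<in> ?V" if "a \<in> ?V" for a
      using that by (rule f)
    show "f a \<in> ?NG b \<longleftrightarrow> a \<in> ?NG (f b)" if "a \<in> ?V" "b \<in> ?V" for a b
      using symH[of "f a" "f b"] symG[of a "f b"] f(2) that by simp
    show "f a \<in> ?NG a" if "a \<in> ?V" for a
      using f(2)[OF that] refl by simp
    show "?NG a = ?NG b" if "a \<in> ?V" "b \<in> ?V" "?NG (f a) = ?NG (f b)" for a b
      using twins[of "f a" "f b"] f that by simp
  qed
  have f_twin: "?NG (f a) = ?NG a" if a: "a \<in> ?V" for a
  proof -
    have "f a \<in> ?NG b \<longleftrightarrow> a \<in> ?NG b" if "b \<in> ?V" for b
      using induced_four_cycle[OF a that] contains_induced_cycle_graph_4[OF assms(1)] assms(2)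
      by metis
    then show ?thesis
      using twins_iff_not_separated[OF assms(1) f(1)[OF a] a] by blast
  qed
  have "?NG a = ?NH a" if a: "a \<in> ?V" for a
  proof -
    obtain b where b: "b \<in> ?V" "?NH a = ?NG b"
      using supp a by blast
    \<comment> \<open>\<open>f b\<close> is a twin of \<open>a\<close> in \<open>H\<close>, hence also in \<open>G\<close>, where it is a twin of \<open>b\<close> as well.\<close>
    have "?NG a = ?NG (f b)"
      using twins[OF a f(1)[OF b(1)]] b f(2) by simp
    with f_twin[OF b(1)] b(2) show ?thesis
      by simp
  qed
  then show "G = H"
    using pair_graph_eqI[OF assms(1) H V] by blast
qed

end
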